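(* Let $(X,d)$ be a quasi-metric space that is $\alpha$-Ahlfors with measure $\mu$, and let $F$ be closed in $X$. If $(F,d)$ is $s$-Ahlfors with measure $\nu$, where $0\le s<\alpha$, then $M_\mu\nu(x)<\infty$ for $\mu$-almost every $x\in X$.
   Context: A quasi-distance on a set $X$ is a non-negative symmetric function $d$ on $X\times X$ with $d(x,y)=0$ iff $x=y$ and $d(x,y)\le K(d(x,z)+d(z,y))$ for all $x,y,z$, for some constant $K\ge1$. Balls are $B(x,r)=\{y\in X: d(x,y)<r\}$; they generate the topology of $X$, and it is assumed throughout that all balls are open sets. $\mathrm{diam}(E)=\sup\{d(x,y):x,y\in E\}$. A subspace $(Y,d)$ of a quasi-metric space $(X,d)$ is $\alpha$-Ahlfors with measure $\mu$ if $\mu$ is a (non-negative) Borel measure supported in $Y$, finite on balls, and there is a constant $c\ge1$ with $c^{-1}r^\alpha\le\mu(B(x,r))\le c\,r^\alpha$ for every $x\in Y$ and every $0<r<\mathrm{diam}(Y)$. The ambient $\alpha$-Ahlfors space $(X,d)$ with measure $\mu$ is regarded as a non-atomic space of homogeneous type (i.e. $0<\mu(B(x,2r))\le A\mu(B(x,r))<\infty$ for all $x,r$, and points have measure zero). $M_\mu\nu(x)=\sup_{r>0}\frac{\nu(B(x,r))}{\mu(B(x,r))}$ for a non-negative Borel measure $\nu$ finite on balls. *)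

theory Defs
  imports "HOL-Analysis.Analysis"
begin

definition quasi_metric_on :: "'a set \<Rightarrow> ('a \<Rightarrow> 'a \<Rightarrow> real) \<Rightarrow> bool" where
  "quasi_metric_on X d \<longleftrightarrow>
     (\<forall>x\<in>X. \<forall>y\<in>X. 0 \<le> d x y \<and> d x y = d y x \<and> (d x y = 0 \<longleftrightarrow> x = y)) \<and>
     (\<exists>K\<ge>1. \<forall>x\<in>X. \<forall>y\<in>X. \<forall>z\<in>X. d x y \<le> K * (d x z + d z y))"

definition qball :: "'a set \<Rightarrow> ('a \<Rightarrow> 'a \<Rightarrow> real) \<Rightarrow> 'a \<Rightarrow> real \<Rightarrow> 'a set" where
  "qball X d x r = {y\<in>X. d x y < r}"

(* Balls of a quasi-metric need not be open in this topology; that is a separate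
   assumption, under which it coincides with the topology generated by the balls
   (lemma qtopology_eq_generated). *)
definition qtopology :: "'a set \<Rightarrow> ('a \<Rightarrow> 'a \<Rightarrow> real) \<Rightarrow> 'a topology" where
  "qtopology X d = topology (\<lambda>U. U \<subseteq> X \<and> (\<forall>x\<in>U. \<exists>r>0. qball X d x r \<subseteq> U))"

definition open_balls :: "'a set \<Rightarrow> ('a \<Rightarrow> 'a \<Rightarrow> real) \<Rightarrow> bool" where
  "open_balls X d \<longleftrightarrow> (\<forall>x\<in>X. \<forall>r>0. openin (qtopology X d) (qball X d x r))"

definition qdiam :: "('a \<Rightarrow> 'a \<Rightarrow> real) \<Rightarrow> 'a set \<Rightarrow> ennreal" where
  "qdiam d E = (SUP x\<in>E. SUP y\<in>E. ennreal (d x y))"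

definition qborel_measure :: "'a set \<Rightarrow> ('a \<Rightarrow> 'a \<Rightarrow> real) \<Rightarrow> 'a measure \<Rightarrow> bool" where
  "qborel_measure X d \<mu> \<longleftrightarrow>
     space \<mu> = X \<and> sets \<mu> = sigma_sets X {U. openin (qtopology X d) U}"

definition finite_on_balls :: "'a set \<Rightarrow> ('a \<Rightarrow> 'a \<Rightarrow> real) \<Rightarrow> 'a measure \<Rightarrow> bool" where
  "finite_on_balls X d \<mu> \<longleftrightarrow> (\<forall>x\<in>X. \<forall>r>0. emeasure \<mu> (qball X d x r) < \<infinity>)"

(* The subspace Y of X is a-Ahlfors with measure m. The measure lives on the ambient
   space X and is carried by Y, so balls of X and of Y centred in Y have equal measure. *)
definition ahlfors ::
  "'a set \<Rightarrow> ('a \<Rightarrow> 'a \<Rightarrow> real) \<Rightarrow> 'a set \<Rightarrow> real \<Rightarrow> 'a measure \<Rightarrow> bool" where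
  "ahlfors X d Y a m \<longleftrightarrow>
     Y \<subseteq> X \<and> qborel_measure X d m \<and> (AE x in m. x \<in> Y) \<and> finite_on_balls X d m \<and>
     (\<exists>c\<ge>1. \<forall>x\<in>Y. \<forall>r>0. ennreal r < qdiam d Y \<longrightarrow>
        ennreal (r powr a / c) \<le> emeasure m (qball X d x r) \<and>
        emeasure m (qball X d x r) \<le> ennreal (c * r powr a))"

definition nonatomic_homogeneous ::
  "'a set \<Rightarrow> ('a \<Rightarrow> 'a \<Rightarrow> real) \<Rightarrow> 'a measure \<Rightarrow> bool" where
  "nonatomic_homogeneous X d \<mu> \<longleftrightarrow>
     (\<exists>A::real. \<forall>x\<in>X. \<forall>r>0.
        0 < emeasure \<mu> (qball X d x (2 * r)) \<and>
        emeasure \<mu> (qball X d x (2 * r)) \<le> ennreal A * emeasure \<mu> (qball X d x r) \<and>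
        ennreal A * emeasure \<mu> (qball X d x r) < \<infinity>) \<and>
     (\<forall>x\<in>X. emeasure \<mu> {x} = 0)"

definition maximal_fn ::
  "'a set \<Rightarrow> ('a \<Rightarrow> 'a \<Rightarrow> real) \<Rightarrow> 'a measure \<Rightarrow> 'a measure \<Rightarrow> 'a \<Rightarrow> ennreal" where
  "maximal_fn X d \<mu> \<nu> x =
     (SUP r\<in>{0<..}. emeasure \<nu> (qball X d x r) / emeasure \<mu> (qball X d x r))"

lemma openin_qtopology:
  "openin (qtopology X d) U \<longleftrightarrow> U \<subseteq> X \<and> (\<forall>x\<in>U. \<exists>r>0. qball X d x r \<subseteq> U)"
proof -
  have "istopology (\<lambda>U. U \<subseteq> X \<and> (\<forall>x\<in>U. \<exists>r>0. qball X d x r \<subseteq> U))"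
    unfolding istopology_def
  proof (intro conjI allI impI ballI)
    fix S T x
    assume S: "S \<subseteq> X \<and> (\<forall>x\<in>S. \<exists>r>0. qball X d x r \<subseteq> S)"
      and T: "T \<subseteq> X \<and> (\<forall>x\<in>T. \<exists>r>0. qball X d x r \<subseteq> T)" and x: "x \<in> S \<inter> T"
    then obtain r q where "r > 0" "qball X d x r \<subseteq> S" "q > 0" "qball X d x q \<subseteq> T"
      by blast
    then show "\<exists>r>0. qball X d x r \<subseteq> S \<inter> T"
      by (intro exI[of _ "min r q"]) (auto simp: qball_def)
  next
    fix \<K> x
    assume K: "\<forall>K\<in>\<K>. K \<subseteq> X \<and> (\<forall>x\<in>K. \<exists>r>0. qball X d x r \<subseteq> K)" and "x \<in> \<Union>\<K>"
    then obtain K r where "K \<in> \<K>" "r > 0" "qball X d x r \<subseteq> K"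
      by blast
    then show "\<exists>r>0. qball X d x r \<subseteq> \<Union>\<K>"
      by blast
  qed blast+
  then show ?thesis
    by (simp add: qtopology_def topology_inverse')
qed

lemma qtopology_eq_generated:
  assumes "quasi_metric_on X d" "open_balls X d"
  shows "qtopology X d = topology_generated_by {qball X d x r |x r. x \<in> X \<and> r > 0}"
    (is "_ = topology_generated_by ?B")
proof (rule topology_eq[THEN iffD2], intro allI iffI)
  fix U
  assume U: "openin (qtopology X d) U"
  show "openin (topology_generated_by ?B) U"
  proof (subst openin_subopen, intro ballI)
    fix x
    assume "x \<in> U"
    then have x: "x \<in> X" and "\<exists>r>0. qball X d x r \<subseteq> U"
      using U unfolding openin_qtopology by auto
    then obtain r where r: "r > 0" "qball X d x r \<subseteq> U"
      by blast
    have "d x x = 0"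
      using assms(1) x unfolding quasi_metric_on_def by blast
    then have "x \<in> qball X d x r"
      using x r(1) by (simp add: qball_def)
    moreover have "openin (topology_generated_by ?B) (qball X d x r)"
      using x r(1) by (intro topology_generated_by_Basis) blast
    ultimately show "\<exists>T. openin (topology_generated_by ?B) T \<and> x \<in> T \<and> T \<subseteq> U"
      using r(2)
      by (intro exI[of _ "qball X d x r"] conjI)
  qed
next
  fix U
  assume "openin (topology_generated_by ?B) U"
  then have "generate_topology_on ?B U"
    by (simp add: openin_topology_generated_by_iff)
  then show "openin (qtopology X d) U"
  proof induction
    case (Basis s)
    then show ?case
      using assms(2) by (auto simp: open_balls_def)
  next
    case (UN K)
    then show ?case
      by (intro openin_Union) blast
  qed (simp_all add: openin_Int)
qed

end

theory Submission
  imports Defs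
begin

text \<open>
  The exceptional set is \<open>F\<close> itself: \<open>F\<close> has measure zero because its dimension is too small,
  and off \<open>F\<close> the maximal function is finite because \<open>\<nu>\<close> does not see small balls and grows
  more slowly than \<open>\<mu>\<close> on large ones.

  \<^bold>\<open>Measure zero.\<close> Fix a bounded piece \<open>A\<close> of \<open>F\<close> and a small \<open>t\<close>, and let \<open>K\<close> be the constant of
  the quasi-triangle inequality. If the points of \<open>S \<subseteq> A\<close> are \<open>2Kt\<close>-separated, their balls of radius
  \<open>t\<close> are disjoint, each has \<open>\<nu>\<close>-measure at least a constant times \<open>t\<^sup>s\<close>, and all lie in one fixed
  ball of finite \<open>\<nu>\<close>-measure; hence \<open>S\<close> has at most a constant times \<open>t powr (- s)\<close> points
  (\<open>card_separated_mult_le_emeasure\<close>). If \<open>S\<close> is as large as possible, its balls of radius \<open>2Kt\<close>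
  cover \<open>A\<close> (\<open>ex_covering_separated\<close>), and each has \<open>\<mu>\<close>-measure at most a constant times
  \<open>t powr \<alpha>\<close>. So \<open>\<mu> A\<close> is at most a constant times \<open>t powr (\<alpha> - s)\<close>, which tends to zero with \<open>t\<close>
  (\<open>lower_dim_null_sets\<close>). This needs radii below the diameter of \<open>F\<close>; if \<open>F\<close> has at most one
  point there are none, and \<open>F\<close> is null because \<open>\<mu>\<close> has no atoms.

  \<^bold>\<open>Finiteness.\<close> A point \<open>x\<close> outside the closed set \<open>F\<close> has a ball of some radius \<open>r0\<close> that misses
  \<open>F\<close>, so only radii \<open>r \<ge> r0\<close> contribute. If \<open>F\<close> is bounded, \<open>\<nu>\<close> is a finite measure and the
  quotients are at most the total mass over \<open>\<mu> (B(x, r0)) > 0\<close>. If \<open>F\<close> is unbounded, so is \<open>X\<close>,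
  and both Ahlfors estimates hold at all radii; \<open>B(x, r)\<close> lies in a ball of comparable radius
  centred in \<open>F\<close>, so the quotient is at most a constant times \<open>r powr (s - \<alpha>)\<close>, which is bounded
  for \<open>r \<ge> r0\<close> (\<open>maximal_fn_finite_off_support\<close>).
\<close>

section \<open>Quasi-metrics, balls and diameters\<close>

lemma quasi_triangleE:
  assumes "quasi_metric_on X d"
  obtains K :: real where "1 \<le> K"
    and "\<And>x y z. x \<in> X \<Longrightarrow> y \<in> X \<Longrightarrow> z \<in> X \<Longrightarrow> d x y \<le> K * (d x z + d z y)"
proof -
  have "\<exists>K\<ge>1. \<forall>x\<in>X. \<forall>y\<in>X. \<forall>z\<in>X. d x y \<le> K * (d x z + d z y)"
    using assms by (simp only: quasi_metric_on_def)
  then show thesis using that by blast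
qed

lemma quasi_metric_onD:
  assumes "quasi_metric_on X d" "x \<in> X" "y \<in> X"
  shows quasi_metric_nonneg: "0 \<le> d x y"
    and quasi_metric_commute: "d x y = d y x"
    and quasi_metric_eq_0_iff: "d x y = 0 \<longleftrightarrow> x = y"
proof -
  have "\<forall>x\<in>X. \<forall>y\<in>X. 0 \<le> d x y \<and> d x y = d y x \<and> (d x y = 0 \<longleftrightarrow> x = y)"
    using assms(1) unfolding quasi_metric_on_def by (rule conjunct1)
  then have "\<forall>y\<in>X. 0 \<le> d x y \<and> d x y = d y x \<and> (d x y = 0 \<longleftrightarrow> x = y)"
    using assms(2) by (rule bspec)
  then have "0 \<le> d x y \<and> d x y = d y x \<and> (d x y = 0 \<longleftrightarrow> x = y)"
    using assms(3) by (rule bspec)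
  then show "0 \<le> d x y" "d x y = d y x" "d x y = 0 \<longleftrightarrow> x = y"
    by blast+
qed

lemma quasi_metric_pos:
  "quasi_metric_on X d \<Longrightarrow> x \<in> X \<Longrightarrow> y \<in> X \<Longrightarrow> x \<noteq> y \<Longrightarrow> 0 < d x y"
  using quasi_metric_nonneg[of X d x y] quasi_metric_eq_0_iff[of X d x y] by linarith

lemma qball_mono: "r \<le> r' \<Longrightarrow> qball X d x r \<subseteq> qball X d x r'"
  by (auto simp: qball_def)

lemma topspace_qtopology: "topspace (qtopology X d) = X"
proof (rule antisym)
  show "topspace (qtopology X d) \<subseteq> X"
    unfolding topspace_def openin_qtopology by blast
  have "qball X d x 1 \<subseteq> X" for x by (simp add: qball_def)
  then have "openin (qtopology X d) X"
    unfolding openin_qtopology using zero_less_one by blast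
  then show "X \<subseteq> topspace (qtopology X d)" by (rule openin_subset)
qed

lemma qdiam_mono: "E \<subseteq> F \<Longrightarrow> qdiam d E \<le> qdiam d F"
  unfolding qdiam_def by (intro SUP_subset_mono order_refl)

lemma dist_le_qdiam:
  assumes "x \<in> E" "y \<in> E"
  shows "ennreal (d x y) \<le> qdiam d E"
proof -
  have "ennreal (d x y) \<le> (SUP y\<in>E. ennreal (d x y))" using assms(2) by (rule SUP_upper)
  also have "\<dots> \<le> qdiam d E" unfolding qdiam_def using assms(1) by (rule SUP_upper)
  finally show ?thesis .
qed

lemma finite_qdiam_subset_qball:
  assumes qm: "quasi_metric_on X d" and "F \<subseteq> X" "x \<in> X" and fin: "qdiam d F < \<infinity>"
  shows "\<exists>R>0. F \<subseteq> qball X d x R"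
proof (cases "F = {}")
  case True
  then show ?thesis by (intro exI[of _ 1]) simp
next
  case False
  then obtain p where p: "p \<in> F" by blast
  obtain K where K: "1 \<le> K"
    "\<And>x y z. x \<in> X \<Longrightarrow> y \<in> X \<Longrightarrow> z \<in> X \<Longrightarrow> d x y \<le> K * (d x z + d z y)"
    by (rule quasi_triangleE[OF qm]) blast
  define D where "D = enn2real (qdiam d F)"
  have D: "d p y \<le> D" if "y \<in> F" for y
  proof -
    have "ennreal (d p y) \<le> ennreal D"
      using dist_le_qdiam[OF p that, of d] fin by (simp add: D_def)
    then show ?thesis by (simp add: D_def)
  qed
  define R where "R = K * (d x p + D) + 1"
  have "0 \<le> d x p" "0 \<le> D"
    using quasi_metric_nonneg[OF qm] assms(2,3) p by (auto simp: D_def)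
  then have "0 \<le> K * (d x p + D)" using K(1) by simp
  then have "0 < R" by (simp add: R_def)
  moreover have "d x y < R" if y: "y \<in> F" for y
  proof -
    have "d x y \<le> K * (d x p + d p y)" using K(2) assms(2,3) p y by blast
    also have "\<dots> \<le> K * (d x p + D)" using D[OF y] K(1) by (intro mult_left_mono) auto
    finally show ?thesis by (simp add: R_def)
  qed
  ultimately have "0 < R \<and> F \<subseteq> qball X d x R"
    using assms(2) by (simp add: qball_def subset_iff)
  then show ?thesis by blast
qed

section \<open>Borel measures and Ahlfors sets\<close>

lemma openin_sets_qborel:
  "qborel_measure X d m \<Longrightarrow> openin (qtopology X d) U \<Longrightarrow> U \<in> sets m"
  by (simp add: qborel_measure_def sigma_sets.Basic)

lemma closedin_sets_qborel:
  assumes "qborel_measure X d m" "closedin (qtopology X d) F"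
  shows "F \<in> sets m"
proof -
  have "openin (qtopology X d) (X - F)" "F \<subseteq> X"
    using assms(2) by (auto simp: closedin_def topspace_qtopology)
  then have "X - F \<in> sets m" using openin_sets_qborel[OF assms(1)] by blast
  moreover have "space m = X" using assms(1) by (simp add: qborel_measure_def)
  moreover have "F = space m - (X - F)" using \<open>F \<subseteq> X\<close> \<open>space m = X\<close> by blast
  ultimately show ?thesis by (metis sets.compl_sets)
qed

lemma qball_sets_qborel:
  assumes "open_balls X d" "qborel_measure X d m" "x \<in> X" "0 < r"
  shows "qball X d x r \<in> sets m"
  using assms openin_sets_qborel unfolding open_balls_def by blast

lemma ahlforsE:
  assumes "ahlfors X d Y a m"
  obtains c :: real where "1 \<le> c"
    and "\<And>x r. x \<in> Y \<Longrightarrow> 0 < r \<Longrightarrow> ennreal r < qdiam d Y \<Longrightarrow>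
           ennreal (r powr a / c) \<le> emeasure m (qball X d x r)"
    and "\<And>x r. x \<in> Y \<Longrightarrow> 0 < r \<Longrightarrow> ennreal r < qdiam d Y \<Longrightarrow>
           emeasure m (qball X d x r) \<le> ennreal (c * r powr a)"
  using assms unfolding ahlfors_def by metis

section \<open>Packing and covering\<close>

text \<open>
  The factor \<open>2K\<close> in the separation is what makes balls of radius \<open>t\<close> disjoint: a common point would
  put the centres at distance less than \<open>K (t + t)\<close>.
\<close>

lemma card_separated_mult_le_emeasure:
  fixes K t :: real
  assumes qm: "quasi_metric_on X d"
    and tri: "\<And>x y z. x \<in> X \<Longrightarrow> y \<in> X \<Longrightarrow> z \<in> X \<Longrightarrow> d x y \<le> K * (d x z + d z y)"
    and K: "1 \<le> K"
    and fin: "finite S" and "S \<subseteq> X"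
    and sep: "\<And>x y. x \<in> S \<Longrightarrow> y \<in> S \<Longrightarrow> x \<noteq> y \<Longrightarrow> 2 * K * t \<le> d x y"
    and meas: "\<And>x. x \<in> S \<Longrightarrow> qball X d x t \<in> sets m"
    and sub: "\<And>x. x \<in> S \<Longrightarrow> qball X d x t \<subseteq> E" and "E \<in> sets m"
    and lower: "\<And>x. x \<in> S \<Longrightarrow> b \<le> emeasure m (qball X d x t)"
  shows "of_nat (card S) * b \<le> emeasure m E"
proof -
  have "disjoint_family_on (\<lambda>x. qball X d x t) S"
    unfolding disjoint_family_on_def
  proof (intro ballI impI)
    fix x y assume xy: "x \<in> S" "y \<in> S" "x \<noteq> y"
    have False if "z \<in> qball X d x t" "z \<in> qball X d y t" for z
    proof -
      have z: "z \<in> X" "d x z < t" "d y z < t" using that by (auto simp: qball_def)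
      have "d z y = d y z" using xy \<open>S \<subseteq> X\<close> z by (intro quasi_metric_commute[OF qm]) auto
      have "d x y \<le> K * (d x z + d z y)" using tri xy \<open>S \<subseteq> X\<close> z by blast
      also have "\<dots> < K * (t + t)" using z \<open>d z y = d y z\<close> K by (intro mult_strict_left_mono) auto
      finally show False using sep[OF xy] by simp
    qed
    then show "qball X d x t \<inter> qball X d y t = {}" by blast
  qed
  then have eq: "(\<Sum>x\<in>S. emeasure m (qball X d x t)) = emeasure m (\<Union>x\<in>S. qball X d x t)"
    using fin meas by (intro sum_emeasure) auto
  have "of_nat (card S) * b = (\<Sum>x\<in>S. b)" by simp
  also have "\<dots> \<le> emeasure m (\<Union>x\<in>S. qball X d x t)"
    unfolding eq[symmetric] by (rule sum_mono) (rule lower)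
  also have "\<dots> \<le> emeasure m E" using sub \<open>E \<in> sets m\<close> by (intro emeasure_mono) auto
  finally show ?thesis .
qed

text \<open>
  A uniform bound on the size of separated subsets lets one choose a separated subset of largest
  cardinality; a point far from all of it could be added, so it is an \<open>r\<close>-net. Choosing by
  cardinality avoids any appeal to Zorn's lemma and gives a finite net.
\<close>

lemma ex_covering_separated:
  fixes d :: "'a \<Rightarrow> 'a \<Rightarrow> real" and N :: nat
  assumes sym: "\<And>x y. x \<in> A \<Longrightarrow> y \<in> A \<Longrightarrow> d x y = d y x"
    and bound: "\<And>S. finite S \<Longrightarrow> S \<subseteq> A \<Longrightarrow>
      (\<And>x y. x \<in> S \<Longrightarrow> y \<in> S \<Longrightarrow> x \<noteq> y \<Longrightarrow> r \<le> d x y) \<Longrightarrow> card S \<le> N"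
    and self: "\<And>x. x \<in> A \<Longrightarrow> d x x < r"
  obtains S where "finite S" "S \<subseteq> A"
    "\<And>x y. x \<in> S \<Longrightarrow> y \<in> S \<Longrightarrow> x \<noteq> y \<Longrightarrow> r \<le> d x y"
    "\<And>y. y \<in> A \<Longrightarrow> \<exists>x\<in>S. d x y < r"
proof -
  define P where "P S \<longleftrightarrow> finite S \<and> S \<subseteq> A \<and> (\<forall>x\<in>S. \<forall>y\<in>S. x \<noteq> y \<longrightarrow> r \<le> d x y)" for S
  have "\<forall>S. P S \<longrightarrow> card S < Suc N"
  proof (intro allI impI)
    fix S assume "P S"
    then show "card S < Suc N" using bound[of S] unfolding P_def by (simp add: less_Suc_eq_le)
  qed
  moreover have "P {}" by (simp add: P_def)
  ultimately obtain S where S: "P S" and max: "\<And>T. P T \<Longrightarrow> card T \<le> card S"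
    using Lattices_Big.ex_has_greatest_nat[of P "{}" card "Suc N"] by blast
  have cover: "\<exists>x\<in>S. d x y < r" if y: "y \<in> A" for y
  proof (rule ccontr)
    assume far: "\<not> (\<exists>x\<in>S. d x y < r)"
    then have "y \<notin> S" using self y by blast
    moreover have "P (insert y S)"
    proof -
      have "r \<le> d x y \<and> r \<le> d y x" if "x \<in> S" for x
        using far sym[of x y] that S y unfolding P_def by (metis not_less subsetD)
      then show ?thesis using S y unfolding P_def by auto
    qed
    ultimately show False using max[of "insert y S"] S by (simp add: P_def)
  qed
  show thesis
    by (rule that[of S]) (use S cover in \<open>auto simp: P_def\<close>)
qed

text \<open>
  The packing bound comes from \<open>\<nu>\<close> at scale \<open>t\<close>, the covering bound from \<open>\<mu>\<close> at scale \<open>2Kt\<close>. The two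
  distinct points make the diameter of \<open>F\<close> positive, so that both Ahlfors estimates are available
  at all small scales.
\<close>

lemma lower_dim_null_sets:
  assumes qm: "quasi_metric_on X d" and ob: "open_balls X d"
    and aX: "ahlfors X d X \<alpha> \<mu>" and aF: "ahlfors X d F s \<nu>" and "s < \<alpha>"
    and F: "F \<in> sets \<mu>" and pq: "p \<in> F" "q \<in> F" "p \<noteq> q"
  shows "F \<in> null_sets \<mu>"
proof -
  obtain K where K: "1 \<le> K"
    and tri: "\<And>x y z. x \<in> X \<Longrightarrow> y \<in> X \<Longrightarrow> z \<in> X \<Longrightarrow> d x y \<le> K * (d x z + d z y)"
    by (rule quasi_triangleE[OF qm]) blast
  obtain c where c: "1 \<le> c"
    and up: "\<And>x r. x \<in> X \<Longrightarrow> 0 < r \<Longrightarrow> ennreal r < qdiam d X \<Longrightarrow>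
           emeasure \<mu> (qball X d x r) \<le> ennreal (c * r powr \<alpha>)"
    using ahlforsE[OF aX] by metis
  obtain b where b: "1 \<le> b"
    and low: "\<And>x r. x \<in> F \<Longrightarrow> 0 < r \<Longrightarrow> ennreal r < qdiam d F \<Longrightarrow>
           ennreal (r powr s / b) \<le> emeasure \<nu> (qball X d x r)"
    using ahlforsE[OF aF] by metis
  have FX: "F \<subseteq> X" and q\<nu>: "qborel_measure X d \<nu>" and q\<mu>: "qborel_measure X d \<mu>"
    and fb: "finite_on_balls X d \<nu>"
    using aX aF by (auto simp: ahlfors_def)
  define \<delta> where "\<delta> = d p q"
  have \<delta>: "0 < \<delta>" using quasi_metric_pos[OF qm] pq FX by (auto simp: \<delta>_def)
  have small: "ennreal r < qdiam d F" "ennreal r < qdiam d X" if "r < \<delta>" for r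
  proof -
    have "ennreal r < ennreal \<delta>" using that \<delta> by (simp add: ennreal_lessI)
    also have "\<dots> \<le> qdiam d F" unfolding \<delta>_def using pq by (intro dist_le_qdiam)
    finally show "ennreal r < qdiam d F" .
    also have "\<dots> \<le> qdiam d X" using FX by (rule qdiam_mono)
    finally show "ennreal r < qdiam d X" .
  qed
  have null: "emeasure \<mu> (F \<inter> qball X d p R) = 0" if R: "0 < R" for R
  proof -
    define A where "A = F \<inter> qball X d p R"
    \<comment> \<open>\<open>E\<close> contains every ball of radius less than 1 centred in \<open>A\<close>, so one finite mass
      bounds the packings at all small scales.\<close>
    define E where "E = qball X d p (K * (R + 1))"
    have R': "0 < K * (R + 1)" using K R by simp
    have E: "E \<in> sets \<nu>" "emeasure \<nu> E < \<infinity>"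
      using ob q\<nu> pq(1) FX R' fb unfolding E_def
      by (auto intro!: qball_sets_qborel simp: finite_on_balls_def)
    define V where "V = enn2real (emeasure \<nu> E)"
    have V: "0 \<le> V" "emeasure \<nu> E = ennreal V" using E by (auto simp: V_def)
    define C where "C = V * b * (c * (2 * K) powr \<alpha>)"
    have bound: "emeasure \<mu> A \<le> ennreal (C * t powr (\<alpha> - s))"
      if t: "0 < t" "t < 1" "2 * K * t < \<delta>" for t
    proof -
      have "t \<le> 2 * K * t" using K t by simp
      then have t\<delta>: "t < \<delta>" using t by linarith
      have card: "real (card S) \<le> V * b / t powr s"
        if S: "finite S" "S \<subseteq> A"
          "\<And>x y. x \<in> S \<Longrightarrow> y \<in> S \<Longrightarrow> x \<noteq> y \<Longrightarrow> 2 * K * t \<le> d x y" for S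
      proof -
        have sub: "qball X d x t \<subseteq> E" if x: "x \<in> S" for x
        proof
          fix z assume z: "z \<in> qball X d x t"
          have "d p z \<le> K * (d p x + d x z)"
            using tri[of p z x] z x S(2) pq FX by (auto simp: A_def qball_def)
          also have "\<dots> < K * (R + 1)"
            using z x S(2) t K by (intro mult_strict_left_mono) (auto simp: A_def qball_def)
          finally show "z \<in> E" using z by (auto simp: E_def qball_def)
        qed
        have "of_nat (card S) * ennreal (t powr s / b) \<le> emeasure \<nu> E"
        proof (rule card_separated_mult_le_emeasure[OF qm tri K S(1) _ S(3)])
          show "S \<subseteq> X" using S(2) FX by (auto simp: A_def)
          show "qball X d x t \<in> sets \<nu>" if "x \<in> S" for x
            using that S(2) FX by (intro qball_sets_qborel ob q\<nu> t) (auto simp: A_def)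
          show "ennreal (t powr s / b) \<le> emeasure \<nu> (qball X d x t)" if "x \<in> S" for x
            using that S(2) by (intro low t small t\<delta>) (auto simp: A_def)
        qed (use sub E in auto)
        then have "ennreal (real (card S) * (t powr s / b)) \<le> ennreal V"
          using b by (subst ennreal_mult) (simp_all add: V(2) ennreal_of_nat_eq_real_of_nat)
        then have "real (card S) * (t powr s / b) \<le> V" using V(1) by (simp add: ennreal_le_iff)
        then show ?thesis using b t by (simp add: field_simps)
      qed
      obtain S where S: "finite S" "S \<subseteq> A"
        and sep: "\<And>x y. x \<in> S \<Longrightarrow> y \<in> S \<Longrightarrow> x \<noteq> y \<Longrightarrow> 2 * K * t \<le> d x y"
        and cover: "\<And>y. y \<in> A \<Longrightarrow> \<exists>x\<in>S. d x y < 2 * K * t"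
      proof (rule ex_covering_separated[of A d "2 * K * t" "nat \<lceil>V * b / t powr s\<rceil>"])
        show "d x y = d y x" if "x \<in> A" "y \<in> A" for x y
          using that FX by (intro quasi_metric_commute[OF qm]) (auto simp: A_def)
        show "d x x < 2 * K * t" if "x \<in> A" for x
          using that FX quasi_metric_eq_0_iff[OF qm, of x x] K t by (auto simp: A_def)
        show "card S \<le> nat \<lceil>V * b / t powr s\<rceil>"
          if "finite S" "S \<subseteq> A"
            "\<And>x y. x \<in> S \<Longrightarrow> y \<in> S \<Longrightarrow> x \<noteq> y \<Longrightarrow> 2 * K * t \<le> d x y" for S
          using card[OF that] by linarith
      qed blast
      have mS: "qball X d x (2 * K * t) \<in> sets \<mu>" if "x \<in> S" for x
        using that S(2) FX K t by (intro qball_sets_qborel ob q\<mu>) (auto simp: A_def)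
      have "A \<subseteq> (\<Union>x\<in>S. qball X d x (2 * K * t))"
        using cover FX by (auto simp: A_def qball_def)
      then have "emeasure \<mu> A \<le> emeasure \<mu> (\<Union>x\<in>S. qball X d x (2 * K * t))"
        using mS S(1) by (intro emeasure_mono) auto
      also have "\<dots> \<le> (\<Sum>x\<in>S. emeasure \<mu> (qball X d x (2 * K * t)))"
        using mS S(1) by (intro emeasure_subadditive_finite) auto
      also have "\<dots> \<le> (\<Sum>x\<in>S. ennreal (c * (2 * K * t) powr \<alpha>))"
        using S(2) FX K t by (intro sum_mono up small) (auto simp: A_def)
      also have "\<dots> = ennreal (real (card S) * (c * (2 * K * t) powr \<alpha>))"
        using c by (simp add: ennreal_mult ennreal_of_nat_eq_real_of_nat)
      also have "\<dots> \<le> ennreal (V * b / t powr s * (c * (2 * K * t) powr \<alpha>))"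
        using card[OF S sep] c by (intro ennreal_leI mult_right_mono) auto
      also have "V * b / t powr s * (c * (2 * K * t) powr \<alpha>) = C * t powr (\<alpha> - s)"
        using K t by (simp add: C_def powr_mult powr_diff)
      finally show ?thesis .
    qed
    \<comment> \<open>The bound on the fixed number \<open>\<mu> A\<close> vanishes as the scale tends to zero.\<close>
    have "((\<lambda>t. C * t powr (\<alpha> - s)) \<longlongrightarrow> C * 0 powr (\<alpha> - s)) (at_right 0)"
      using \<open>s < \<alpha>\<close> eventually_at_right_less[of "0::real"]
      by (intro tendsto_intros tendsto_powr') (auto elim!: eventually_mono)
    then have lim: "((\<lambda>t. ennreal (C * t powr (\<alpha> - s))) \<longlongrightarrow> 0) (at_right 0)"
      using tendsto_ennrealI by fastforce
    have "eventually (\<lambda>t. emeasure \<mu> A \<le> ennreal (C * t powr (\<alpha> - s))) (at_right 0)"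
      unfolding eventually_at_right_field
      using K \<delta> bound
      by (intro exI[of _ "min 1 (\<delta> / (2 * K))"]) (auto simp: field_simps)
    then have "emeasure \<mu> A \<le> 0" by (intro tendsto_lowerbound[OF lim]) auto
    then show ?thesis by (simp add: A_def)
  qed
  have "F = (\<Union>n::nat. F \<inter> qball X d p (real n + 1))"
  proof -
    have "\<exists>n::nat. d p x < real n + 1" for x
      by (meson add_strict_increasing2 less_add_one less_trans reals_Archimedean2)
    then show ?thesis using FX by (auto simp: qball_def)
  qed
  moreover have "F \<inter> qball X d p (real n + 1) \<in> null_sets \<mu>" for n :: nat
    using F pq(1) FX null[of "real n + 1"]
    by (intro null_setsI sets.Int qball_sets_qborel ob q\<mu>) auto
  ultimately show ?thesis by (metis null_sets_UN)
qed

section \<open>Finiteness of the maximal function off the set\<close>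

lemma divide_mono_ennreal:
  fixes a b x y :: ennreal
  assumes "a \<le> x" "y \<le> b"
  shows "a / b \<le> x / y"
proof -
  have "inverse b \<le> inverse y"
    using assms(2) including ennreal.lifting by transfer (auto intro: ereal_inverse_antimono)
  then show ?thesis
    unfolding divide_ennreal_def using assms(1) by (intro mult_mono) auto
qed

text \<open>
  The hypothesis \<open>pos\<close> is separate from the Ahlfors condition, which says nothing about radii beyond
  the diameter of \<open>X\<close>. The split is on whether \<open>F\<close> is bounded because the upper estimate for \<open>\<nu>\<close>
  holds at large radii only when it is not; otherwise finiteness of \<open>\<nu>\<close> on balls replaces it.
\<close>

lemma maximal_fn_finite_off_support:
  assumes qm: "quasi_metric_on X d" and ob: "open_balls X d"
    and aX: "ahlfors X d X \<alpha> \<mu>" and aF: "ahlfors X d F s \<nu>" and s: "s < \<alpha>"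
    and pos: "\<And>x r. x \<in> X \<Longrightarrow> 0 < r \<Longrightarrow> 0 < emeasure \<mu> (qball X d x r)"
    and x: "x \<in> X" and r0: "0 < r0" and miss: "qball X d x r0 \<inter> F = {}"
  shows "maximal_fn X d \<mu> \<nu> x < \<infinity>"
proof -
  have FX: "F \<subseteq> X" and q\<nu>: "qborel_measure X d \<nu>" and q\<mu>: "qborel_measure X d \<mu>"
    and AE: "AE x in \<nu>. x \<in> F"
    and fb: "finite_on_balls X d \<nu>"
    using aX aF by (auto simp: ahlfors_def)
  have carried: "emeasure \<nu> A \<le> emeasure \<nu> B" if "A \<inter> F \<subseteq> B" "B \<in> sets \<nu>" for A B
    using AE that by (intro emeasure_mono_AE) (auto elim: eventually_mono)
  have below: "emeasure \<nu> (qball X d x r) = 0" if "r \<le> r0" for r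
    using carried[of "qball X d x r" "{}"] qball_mono[OF that, of X d x] miss by fastforce
  have "\<exists>C<\<infinity>. \<forall>r\<ge>r0. emeasure \<nu> (qball X d x r) / emeasure \<mu> (qball X d x r) \<le> C"
  proof (cases "qdiam d F < \<infinity>")
    case True
    then obtain R where R: "0 < R" "F \<subseteq> qball X d x R"
      using finite_qdiam_subset_qball[OF qm FX x] by blast
    have BR: "qball X d x R \<in> sets \<nu>" by (intro qball_sets_qborel ob q\<nu> x R)
    let ?C = "emeasure \<nu> (qball X d x R) / emeasure \<mu> (qball X d x r0)"
    have "emeasure \<nu> (qball X d x R) < \<infinity>"
      using fb x R by (simp add: finite_on_balls_def)
    then have "?C < \<infinity>"
      using pos[OF x r0] by (auto simp: ennreal_divide_eq_top_iff less_top[symmetric])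
    moreover have "emeasure \<nu> (qball X d x r) / emeasure \<mu> (qball X d x r) \<le> ?C"
      if r: "r0 \<le> r" for r
      using r R(2) r0 BR
      by (intro divide_mono_ennreal carried emeasure_mono qball_mono qball_sets_qborel[OF ob q\<mu> x]) auto
    ultimately show ?thesis by blast
  next
    case False
    then have inf: "qdiam d F = \<infinity>" by (simp add: less_top[symmetric])
    then have infX: "qdiam d X = \<infinity>" using qdiam_mono[OF FX, of d] by (simp add: top_unique)
    have "F \<noteq> {}"
    proof
      assume "F = {}"
      then have "qdiam d F = 0" by (simp add: qdiam_def bot_ennreal)
      then show False using inf by simp
    qed
    then obtain p where p: "p \<in> F" by blast
    then have pX: "p \<in> X" using FX by blast
    obtain K where K: "1 \<le> K"
      and tri: "\<And>x y z. x \<in> X \<Longrightarrow> y \<in> X \<Longrightarrow> z \<in> X \<Longrightarrow> d x y \<le> K * (d x z + d z y)"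
      by (rule quasi_triangleE[OF qm]) blast
    obtain c where c: "1 \<le> c"
      and low: "\<And>x r. x \<in> X \<Longrightarrow> 0 < r \<Longrightarrow> ennreal (r powr \<alpha> / c) \<le> emeasure \<mu> (qball X d x r)"
      using ahlforsE[OF aX] infX by (metis ennreal_less_top infinity_ennreal_def)
    obtain b where b: "1 \<le> b"
      and up: "\<And>x r. x \<in> F \<Longrightarrow> 0 < r \<Longrightarrow> emeasure \<nu> (qball X d x r) \<le> ennreal (b * r powr s)"
      using ahlforsE[OF aF] inf by (metis ennreal_less_top infinity_ennreal_def)
    \<comment> \<open>For \<open>r \<ge> r0\<close> the distance from \<open>p\<close> to \<open>x\<close> is at most a multiple of \<open>r\<close>, so a ball of radius
      \<open>L r\<close> around \<open>p\<close> contains \<open>B(x, r)\<close>.\<close>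
    define L where "L = K * (d p x / r0 + 1)"
    have px: "0 \<le> d p x" using quasi_metric_nonneg[OF qm pX x] .
    have L: "0 < L" using K px r0 by (auto simp: L_def intro!: mult_pos_pos add_nonneg_pos)
    let ?C = "ennreal (b * c * L powr s * r0 powr (s - \<alpha>))"
    have "emeasure \<nu> (qball X d x r) / emeasure \<mu> (qball X d x r) \<le> ?C" if r: "r0 \<le> r" for r
    proof -
      have rp: "0 < r" using r r0 by simp
      have sub: "qball X d x r \<subseteq> qball X d p (L * r)"
      proof
        fix z assume z: "z \<in> qball X d x r"
        have "d p z \<le> K * (d p x + d x z)" using tri z x pX by (auto simp: qball_def)
        also have "\<dots> < K * (d p x + r)"
          using z K by (intro mult_strict_left_mono) (auto simp: qball_def)
        also have "\<dots> \<le> K * (d p x / r0 * r + r)"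
        proof -
          have "d p x * r0 \<le> d p x * r" using r px by (intro mult_left_mono)
          then have "d p x \<le> d p x / r0 * r" using r0 by (simp add: field_simps)
          then show ?thesis using K by (intro mult_left_mono) auto
        qed
        also have "\<dots> = L * r" by (simp add: L_def algebra_simps)
        finally show "z \<in> qball X d p (L * r)" using z by (auto simp: qball_def)
      qed
      have "emeasure \<nu> (qball X d x r) \<le> emeasure \<nu> (qball X d p (L * r))"
        using L rp by (intro emeasure_mono sub qball_sets_qborel ob q\<nu> pX) auto
      also have "\<dots> \<le> ennreal (b * (L * r) powr s)" using p L rp by (intro up) auto
      finally have "emeasure \<nu> (qball X d x r) / emeasure \<mu> (qball X d x r)
          \<le> ennreal (b * (L * r) powr s) / ennreal (r powr \<alpha> / c)"
        using x rp by (intro divide_mono_ennreal low)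
      also have "\<dots> = ennreal (b * c * L powr s * r powr (s - \<alpha>))"
        using b c rp L by (subst divide_ennreal) (auto simp: powr_mult powr_diff field_simps)
      also have "\<dots> \<le> ?C"
        using s r r0 b c by (intro ennreal_leI mult_left_mono powr_mono2') auto
      finally show ?thesis .
    qed
    then show ?thesis by (intro exI[of _ ?C]) auto
  qed
  then obtain C where C: "C < \<infinity>"
    "\<And>r. r0 \<le> r \<Longrightarrow> emeasure \<nu> (qball X d x r) / emeasure \<mu> (qball X d x r) \<le> C" by blast
  have "maximal_fn X d \<mu> \<nu> x \<le> C"
    unfolding maximal_fn_def
  proof (rule SUP_least)
    fix r :: real
    show "emeasure \<nu> (qball X d x r) / emeasure \<mu> (qball X d x r) \<le> C"
      using C(2)[of r] below[of r] by (cases "r0 \<le> r") auto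
  qed
  then show ?thesis using C(1) by (rule le_less_trans)
qed

section \<open>Almost everywhere finiteness\<close>

theorem proposition2:
  fixes X F :: "'a set" and d :: "'a \<Rightarrow> 'a \<Rightarrow> real"
    and \<alpha> s :: real and \<mu> \<nu> :: "'a measure"
  assumes "quasi_metric_on X d"
    and "open_balls X d"
    and "ahlfors X d X \<alpha> \<mu>"
    and "nonatomic_homogeneous X d \<mu>"
    and "closedin (qtopology X d) F"
    and "ahlfors X d F s \<nu>"
    and "0 \<le> s" and "s < \<alpha>"
  shows "AE x in \<mu>. maximal_fn X d \<mu> \<nu> x < \<infinity>"
proof (rule AE_I')
  have q\<mu>: "qborel_measure X d \<mu>" and FX: "F \<subseteq> X"
    using assms(3,6) by (auto simp: ahlfors_def)
  have F: "F \<in> sets \<mu>" by (rule closedin_sets_qborel[OF q\<mu> assms(5)])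
  show "F \<in> null_sets \<mu>"
  proof (cases "\<exists>p\<in>F. \<exists>q\<in>F. p \<noteq> q")
    case True
    then show ?thesis using lower_dim_null_sets[OF assms(1,2,3,6,8) F] by blast
  next
    case False
    show ?thesis
    proof (cases "F = {}")
      case False
      then obtain p where "p \<in> F" by blast
      with \<open>\<not> (\<exists>p\<in>F. \<exists>q\<in>F. p \<noteq> q)\<close> have "F = {p}" by auto
      moreover have "p \<in> X" using \<open>p \<in> F\<close> FX by blast
      ultimately show ?thesis
        using F assms(4) by (simp add: nonatomic_homogeneous_def null_sets_def)
    qed simp
  qed
  have pos: "0 < emeasure \<mu> (qball X d x r)" if "x \<in> X" "0 < r" for x r
  proof -
    have "0 < emeasure \<mu> (qball X d x (2 * (r / 2)))"
      using assms(4) that unfolding nonatomic_homogeneous_def by (meson half_gt_zero)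
    then show ?thesis by simp
  qed
  show "{x \<in> space \<mu>. \<not> maximal_fn X d \<mu> \<nu> x < \<infinity>} \<subseteq> F"
  proof
    fix x assume "x \<in> {x \<in> space \<mu>. \<not> maximal_fn X d \<mu> \<nu> x < \<infinity>}"
    then have x: "x \<in> X" "\<not> maximal_fn X d \<mu> \<nu> x < \<infinity>"
      using q\<mu> by (auto simp: qborel_measure_def)
    show "x \<in> F"
    proof (rule ccontr)
      assume "x \<notin> F"
      moreover have "openin (qtopology X d) (topspace (qtopology X d) - F)"
        using assms(5) by (simp add: closedin_def)
      moreover have "topspace (qtopology X d) = X" by (rule topspace_qtopology)
      ultimately obtain r where "0 < r" "qball X d x r \<subseteq> X - F"
        using x(1) unfolding openin_qtopology by blast
      then have "0 < r" "qball X d x r \<inter> F = {}" by auto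
      then show False
        using maximal_fn_finite_off_support[OF assms(1-3,6,8) pos x(1)] x(2) by blast
    qed
  qed
qed

end
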